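(* Let $\Gamma$ be a finite, connected, simple, undirected graph with at least one edge, $G$ a group, and $s_1\in Z(G)$ with $s_1^2=1_G$. For $H_1,H_2\in\mathcal H_\Gamma$, one has $H_1\sim_r H_2$ if and only if $\Psi(H_1)=\Psi(H_2)$. That is, the orbits of the action $r$ on $\mathcal H_\Gamma$ are exactly the fibers of $\Psi$.
   Context: Fix orders $V_\Gamma=\{v_1,\dots,v_n\}$, $E_\Gamma=\{e_1,\dots,e_m\}$; write $v_i\in e_j$ if $v_i$ is an endpoint of $e_j$. $\mathbb CG$ is the complex group algebra of $G$; matrices over it are multiplied as usual. A $G$-phase of $\Gamma$ is $H\in M_{n\times m}(\mathbb CG)$ with $H_{i,j}\in G$ if $v_i\in e_j$ and $H_{i,j}=0$ otherwise; $\mathcal H_\Gamma$ is their set. For $g\in G^m$, $\underline g=\mathrm{diag}(g_1,\dots,g_m)$; the action $r$ of $G^m$ on $\mathcal H_\Gamma$ is $r(g,H)=H\underline g$, and $H_1\sim_r H_2$ means $H_1=H_2\underline g$ for some $g\in G^m$. $\Psi(H)$ is the $G$-gain function on $\Gamma$ (a map on ordered pairs of adjacent vertices into $G$ with $\psi(v,u)=\psi(u,v)^{-1}$) given by $\Psi(H)(v_i,v_j)=s_1H_{i,k}H_{j,k}^{-1}$ where $e_k=\{v_i,v_j\}$. *)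

theory Defs
  imports
    Complex_Main
    "HOL-Library.FuncSet"
    "HOL-Library.Poly_Mapping"
    "Jordan_Normal_Form.Matrix"
begin

text \<open>
  The group \<open>G\<close> is a type of class \<^class>\<open>group_add\<close>, which is not assumed commutative. Its
  operation is written additively: \<open>g + h\<close>, \<open>- g\<close> and \<open>0\<close> stand for the product, the inverse and
  the identity of \<open>G\<close>. This is the form in which the library provides the monoid algebra: with the
  convolution product, the finitely supported functions \<open>'g \<Rightarrow>\<^sub>0 complex\<close> form the complex group
  algebra of \<open>'g\<close>, so there \<open>+\<close>, \<open>*\<close>, \<open>0\<close>, \<open>1\<close> have their usual meaning.
\<close>

type_synonym 'g group_algebra = "'g \<Rightarrow>\<^sub>0 complex"

definition emb :: "'g::group_add \<Rightarrow> 'g group_algebra" where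
  "emb g = Poly_Mapping.single g 1"

lemma emb_mult: "emb g * emb h = emb (g + h)"
  by (simp add: emb_def mult_single)

lemma emb_zero: "emb 0 = 1"
  by (simp add: emb_def)

lemma emb_inj: "emb g = emb h \<longleftrightarrow> g = h"
  unfolding emb_def by (metis lookup_single_eq lookup_single_not_eq zero_neq_one)

text \<open>The inverse of \<open>emb\<close>; meaningful only on \<open>range emb\<close>.\<close>

definition group_elem :: "'g::group_add group_algebra \<Rightarrow> 'g" where
  "group_elem x = (THE g. x = emb g)"

lemma group_elem_emb [simp]: "group_elem (emb g) = g"
  by (simp add: group_elem_def emb_inj)

definition group_center :: "'g::group_add set" where
  "group_center = {z. \<forall>g. z + g = g + z}"

definition simple_graph :: "'v set \<Rightarrow> 'v set set \<Rightarrow> bool" where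
  "simple_graph V E \<longleftrightarrow> finite V \<and> (\<forall>e\<in>E. e \<subseteq> V \<and> card e = 2)"

text \<open>Ordered pairs of adjacent vertices.\<close>

definition arcs :: "'v set set \<Rightarrow> ('v \<times> 'v) set" where
  "arcs E = {(u, w). {u, w} \<in> E}"

definition connected_graph :: "'v set \<Rightarrow> 'v set set \<Rightarrow> bool" where
  "connected_graph V E \<longleftrightarrow> V \<noteq> {} \<and> (\<forall>u\<in>V. \<forall>w\<in>V. (u, w) \<in> (arcs E)\<^sup>*)"

text \<open>An enumeration of a finite set without repetitions fixes an order on it.\<close>

definition enumerates :: "'a list \<Rightarrow> 'a set \<Rightarrow> bool" where
  "enumerates xs A \<longleftrightarrow> distinct xs \<and> set xs = A"

definition index_in :: "'a list \<Rightarrow> 'a \<Rightarrow> nat" where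
  "index_in xs x = (THE i. i < length xs \<and> xs ! i = x)"

lemma index_in_nth:
  assumes "distinct xs" "i < length xs"
  shows "index_in xs (xs ! i) = i"
  unfolding index_in_def using assms by (auto simp: nth_eq_iff_index_eq)

text \<open>
  Below, \<open>vs\<close> and \<open>es\<close> are the enumerations of vertices and edges; rows and columns are indexed
  from \<open>0\<close>. The set \<open>phases vs es\<close> is \<open>\<H>\<^sub>\<Gamma>\<close>.
\<close>

definition phases :: "'v list \<Rightarrow> 'v set list \<Rightarrow> 'g::group_add group_algebra mat set" where
  "phases vs es =
    {H \<in> carrier_mat (length vs) (length es).
      \<forall>i < length vs. \<forall>j < length es.
        (if vs ! i \<in> es ! j then H $$ (i, j) \<in> range emb else H $$ (i, j) = 0)}"

definition group_power :: "nat \<Rightarrow> 'g::group_add list set" where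
  "group_power m = {gs. length gs = m}"

definition diag_of :: "'g::group_add list \<Rightarrow> 'g group_algebra mat" where
  "diag_of gs = mat_diag (length gs) (\<lambda>j. emb (gs ! j))"

definition act :: "'g::group_add list \<Rightarrow> 'g group_algebra mat \<Rightarrow> 'g group_algebra mat" where
  "act gs H = H * diag_of gs"

definition act_equiv ::
    "'v set list \<Rightarrow> 'g::group_add group_algebra mat \<Rightarrow> 'g group_algebra mat \<Rightarrow> bool" where
  "act_equiv es H1 H2 \<longleftrightarrow> (\<exists>gs \<in> group_power (length es). H1 = act gs H2)"

definition act_orbit ::
    "'v set list \<Rightarrow> 'g::group_add group_algebra mat \<Rightarrow> 'g group_algebra mat set" where
  "act_orbit es H = (\<lambda>gs. act gs H) ` group_power (length es)"

lemma act_in_phases: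
  fixes H :: "'g::group_add group_algebra mat"
  assumes "H \<in> phases vs es" "gs \<in> group_power (length es)"
  shows "act gs H \<in> phases vs es"
proof -
  have H: "H \<in> carrier_mat (length vs) (length es)" and l: "length gs = length es"
    using assms by (auto simp: phases_def group_power_def)
  have "act gs H = Matrix.mat (length vs) (length es) (\<lambda>(i, j). H $$ (i, j) * emb (gs ! j))"
    unfolding act_def diag_of_def l by (rule mat_diag_mult_right[OF H])
  then show ?thesis
    using assms(1) by (fastforce simp: phases_def emb_mult)
qed

text \<open>Functions on arcs are extensional, so that equality only concerns the values on arcs.\<close>

definition gain_functions :: "'v set set \<Rightarrow> ('v \<times> 'v \<Rightarrow> 'g::group_add) set" where
  "gain_functions E =
    {\<psi> \<in> arcs E \<rightarrow>\<^sub>E UNIV. \<forall>(u, w) \<in> arcs E. \<psi> (w, u) = - \<psi> (u, w)}"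

text \<open>The map \<open>\<Psi>\<close>, for a fixed central \<open>s1\<close> whose square is the identity.\<close>

definition gain_of_phase ::
    "'g::group_add \<Rightarrow> 'v list \<Rightarrow> 'v set list \<Rightarrow> 'g group_algebra mat \<Rightarrow> ('v \<times> 'v \<Rightarrow> 'g)" where
  "gain_of_phase s1 vs es H =
    (\<lambda>(u, w) \<in> arcs (set es).
      let i = index_in vs u; j = index_in vs w; k = index_in es {u, w}
      in s1 + group_elem (H $$ (i, k)) + (- group_elem (H $$ (j, k))))"

lemma gain_of_phase_in_gain_functions:
  assumes "s1 \<in> group_center" "s1 + s1 = 0"
  shows "gain_of_phase s1 vs es H \<in> gain_functions (set es)"
proof -
  have s: "- s1 = s1"
    using assms(2) by (simp add: minus_unique)
  have flip: "s1 + b + - a = - (s1 + a + - b)" for a b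
  proof -
    have "s1 + b + - a = s1 + (b + - a)"
      by (rule add.assoc)
    also have "\<dots> = b + - a + s1"
      using assms(1) unfolding group_center_def by blast
    also have "\<dots> = - (s1 + a + - b)"
      by (simp only: minus_add minus_minus s add.assoc)
    finally show ?thesis .
  qed
  show ?thesis
    unfolding gain_functions_def
  proof (intro CollectI conjI ballI)
    show "gain_of_phase s1 vs es H \<in> arcs (set es) \<rightarrow>\<^sub>E UNIV"
      by (simp add: gain_of_phase_def)
  next
    fix p
    assume "p \<in> arcs (set es)"
    then obtain u w where p: "p = (u, w)" "(u, w) \<in> arcs (set es)" "(w, u) \<in> arcs (set es)"
      by (cases p) (auto simp: arcs_def insert_commute)
    have sym: "{w, u} = {u, w}"
      by (rule insert_commute)
    show "case p of (u, w) \<Rightarrow> gain_of_phase s1 vs es H (w, u) = - gain_of_phase s1 vs es H (u, w)"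
      unfolding p(1) prod.case gain_of_phase_def restrict_apply' [OF p(2)] restrict_apply' [OF p(3)]
        Let_def sym
      by (rule flip)
  qed
qed

end

theory Submission
  imports Defs
begin

text \<open>
  Both directions compare entries column by column. Right multiplication by \<open>g\<^sub>k\<close> cancels in
  \<open>H\<^sub>i\<^sub>k H\<^sub>j\<^sub>k\<inverse>\<close>. Conversely, choose one endpoint \<open>v\<^sub>c\<close> of the edge \<open>e\<^sub>k\<close>: equality of the gains
  forces the element that carries \<open>H\<^sub>2\<close> to \<open>H\<^sub>1\<close> at the entry \<open>(c, k)\<close> to do so at the other
  endpoint as well.
\<close>

lemma act_carrier:
  assumes "H \<in> phases vs es" "gs \<in> group_power (length es)"
  shows "act gs H \<in> carrier_mat (length vs) (length es)"
  using act_in_phases[OF assms] by (simp add: phases_def)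

lemma act_index:
  assumes "H \<in> phases vs es" "gs \<in> group_power (length es)" "i < length vs" "k < length es"
  shows "act gs H $$ (i, k) = H $$ (i, k) * emb (gs ! k)"
proof -
  have H: "H \<in> carrier_mat (length vs) (length es)" and l: "length gs = length es"
    using assms by (auto simp: phases_def group_power_def)
  have "act gs H = Matrix.mat (length vs) (length es) (\<lambda>(i, j). H $$ (i, j) * emb (gs ! j))"
    unfolding act_def diag_of_def l by (rule mat_diag_mult_right[OF H])
  then show ?thesis
    using assms(3,4) by simp
qed

text \<open>At an incident position the entry lies in \<open>range emb\<close>, the only place where
  \<open>group_elem\<close> is meaningful. This lets computations with entries be carried out in the
  group itself.\<close>

lemma phase_entry:
  assumes "H \<in> phases vs es" "i < length vs" "k < length es" "vs ! i \<in> es ! k"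
  shows "H $$ (i, k) = emb (group_elem (H $$ (i, k)))"
  using assms by (fastforce simp: phases_def)

lemma phase_entry_zero:
  assumes "H \<in> phases vs es" "i < length vs" "k < length es" "vs ! i \<notin> es ! k"
  shows "H $$ (i, k) = 0"
  using assms by (fastforce simp: phases_def)

lemma group_elem_act:
  assumes "H \<in> phases vs es" "gs \<in> group_power (length es)"
    and "i < length vs" "k < length es" "vs ! i \<in> es ! k"
  shows "group_elem (act gs H $$ (i, k)) = group_elem (H $$ (i, k)) + gs ! k"
  by (metis act_index assms emb_mult group_elem_emb phase_entry)

text \<open>Distinctness makes \<open>index_in\<close> a left inverse of \<open>!\<close>, so the
  descriptions inside \<open>gain_of_phase\<close> reduce to the given positions.\<close>

lemma gain_of_phase_eq:
  assumes "distinct vs" "distinct es" "i < length vs" "j < length vs" "k < length es"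
    and "es ! k = {vs ! i, vs ! j}"
  shows "gain_of_phase s1 vs es H (vs ! i, vs ! j) =
    s1 + group_elem (H $$ (i, k)) + (- group_elem (H $$ (j, k)))"
proof -
  have "(vs ! i, vs ! j) \<in> arcs (set es)"
    using assms(5,6) by (force simp: arcs_def in_set_conv_nth)
  then show ?thesis
    using assms index_in_nth[OF assms(2,5)]
    by (simp add: gain_of_phase_def index_in_nth Let_def)
qed

text \<open>Puts an arbitrary arc into the indexed form that \<open>gain_of_phase_eq\<close>
  expects.\<close>

lemma arcs_cases:
  assumes "simple_graph V (set es)" "set vs = V" "p \<in> arcs (set es)"
  obtains i j k where "i < length vs" "j < length vs" "k < length es"
    "p = (vs ! i, vs ! j)" "es ! k = {vs ! i, vs ! j}"
proof -
  obtain u w where p: "p = (u, w)" "{u, w} \<in> set es"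
    using assms(3) by (auto simp: arcs_def)
  then have "u \<in> set vs" "w \<in> set vs"
    using assms(1,2) by (auto simp: simple_graph_def)
  then obtain i j k where "i < length vs" "vs ! i = u" "j < length vs" "vs ! j = w"
      "k < length es" "es ! k = {u, w}"
    using p(2) by (meson in_set_conv_nth)
  then show thesis
    using p(1) that by blast
qed

lemma gain_of_phase_act:
  assumes "simple_graph V (set es)" "set vs = V" "distinct vs" "distinct es"
    and "H \<in> phases vs es" "gs \<in> group_power (length es)"
  shows "gain_of_phase s1 vs es (act gs H) = gain_of_phase s1 vs es H"
proof
  fix p
  show "gain_of_phase s1 vs es (act gs H) p = gain_of_phase s1 vs es H p"
  proof (cases "p \<in> arcs (set es)")
    case True
    then obtain i j k where k: "i < length vs" "j < length vs" "k < length es"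
        "p = (vs ! i, vs ! j)" "es ! k = {vs ! i, vs ! j}"
      using arcs_cases[OF assms(1,2)] by metis
    \<comment> \<open>Here \<open>b\<close> is \<open>gs ! k\<close>, the common right factor of
      both entries in column \<open>k\<close>. Inversion reverses the order,
      \<open>- (c + b) = - b + - c\<close>, so \<open>b\<close> meets its inverse without any
      commutativity.\<close>
    have "a + b + - (c + b) = a + - c" for a b c :: 'b
      by (simp add: minus_add add.assoc flip: add_uminus_conv_diff)
    with k assms show ?thesis
      by (simp add: gain_of_phase_eq group_elem_act add.assoc del: add_uminus_conv_diff)
  next
    \<comment> \<open>Off the arcs both gains are \<open>undefined\<close>, being restricted
      functions.\<close>
    case False
    then show ?thesis
      by (simp add: gain_of_phase_def)
  qed
qed

lemma act_equiv_if_gain_of_phase_eq: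
  fixes H1 H2 :: "'g::group_add group_algebra mat"
  assumes G: "simple_graph V (set es)" "set vs = V" "distinct vs" "distinct es"
    and H: "H1 \<in> phases vs es" "H2 \<in> phases vs es"
    and gain: "gain_of_phase s1 vs es H1 = gain_of_phase s1 vs es H2"
  shows "act_equiv es H1 H2"
proof -
  define a b where "a i k = group_elem (H1 $$ (i, k))" and "b i k = group_elem (H2 $$ (i, k))"
    for i k
  have edge: "es ! k \<subseteq> set vs \<and> card (es ! k) = 2" if "k < length es" for k
    using G that by (simp add: simple_graph_def)
  have "\<exists>c. c < length vs \<and> vs ! c \<in> es ! k" if k: "k < length es" for k
  proof -
    obtain x where "x \<in> es ! k"
      using edge[OF k] by fastforce
    then show ?thesis
      using edge[OF k] by (metis in_set_conv_nth subsetD)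
  qed
  then obtain c where c: "\<And>k. k < length es \<Longrightarrow> c k < length vs \<and> vs ! c k \<in> es ! k"
    by metis
  \<comment> \<open>The entry at \<open>k\<close> is the unique solution \<open>g\<close> of
    \<open>a (c k) k = b (c k) k + g\<close>, read off at the chosen endpoint; the inverse stands on
    the left because the action multiplies on the right.\<close>
  define gs where "gs = map (\<lambda>k. - b (c k) k + a (c k) k) [0..<length es]"
  have gs: "gs \<in> group_power (length es)"
    by (simp add: gs_def group_power_def)
  have entry: "a i k = b i k + gs ! k"
    if i: "i < length vs" "k < length es" "vs ! i \<in> es ! k" for i k
  proof (cases "i = c k")
    case True
    then show ?thesis
      using that by (simp add: gs_def flip: add.assoc)
  next
    case False
    then have "vs ! i \<noteq> vs ! c k"
      using c i G(3) by (simp add: nth_eq_iff_index_eq)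
    moreover obtain x y where "es ! k = {x, y}"
      using edge[OF i(2)] by (auto simp: card_2_iff)
    \<comment> \<open>An edge has exactly two elements, so the chosen endpoint and any other
      incident vertex exhaust it.\<close>
    ultimately have "es ! k = {vs ! i, vs ! c k}"
      using i(3) c[OF i(2)] by auto
    \<comment> \<open>Both gains are evaluated at the arc from \<open>vs ! i\<close> to
      \<open>vs ! c k\<close>. Cancelling \<open>s1\<close> on the left and moving
      \<open>a (c k) k\<close> to the right-hand side then produces \<open>gs ! k\<close>.\<close>
    then have "s1 + a i k + (- a (c k) k) = s1 + b i k + (- b (c k) k)"
      using gain_of_phase_eq[OF G(3,4) i(1) conjunct1[OF c[OF i(2)]] i(2)] gain
      unfolding a_def b_def by metis
    then have "a i k + (- a (c k) k) = b i k + (- b (c k) k)"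
      by (simp only: add.assoc add_left_cancel)
    then have "a i k = b i k + (- b (c k) k) + a (c k) k"
      by (metis add.assoc add.left_inverse add.right_neutral)
    then show ?thesis
      using i(2) by (simp add: gs_def add.assoc del: add_uminus_conv_diff)
  qed
  have "H1 = act gs H2"
  proof (rule eq_matI)
    fix i k
    assume "i < dim_row (act gs H2)" "k < dim_col (act gs H2)"
    then have ik: "i < length vs" "k < length es"
      using act_carrier[OF H(2) gs] by auto
    show "H1 $$ (i, k) = act gs H2 $$ (i, k)"
    proof (cases "vs ! i \<in> es ! k")
      case True
      then show ?thesis
        using phase_entry[OF H(1) ik] phase_entry[OF H(2) ik] entry[OF ik]
        by (metis H(2) a_def act_index b_def emb_mult gs ik)
    next
      case False
      then show ?thesis
        using phase_entry_zero[OF H(1) ik] phase_entry_zero[OF H(2) ik] H(2) ik gs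
        by (simp add: act_index)
    qed
  qed (use H(1) act_carrier[OF H(2) gs] in \<open>auto simp: phases_def\<close>)
  then show ?thesis
    using gs by (auto simp: act_equiv_def)
qed

theorem theorem4p14:
  fixes V :: "'v set" and E :: "'v set set"
    and vs :: "'v list" and es :: "'v set list"
    and s1 :: "'g::group_add"
  assumes "simple_graph V E" and "connected_graph V E" and "E \<noteq> {}"
    and "enumerates vs V" and "enumerates es E"
    and "s1 \<in> group_center" and "s1 + s1 = 0"
  shows "(\<forall>H1 \<in> (phases vs es :: 'g group_algebra mat set). \<forall>H2 \<in> phases vs es.
            act_equiv es H1 H2 \<longleftrightarrow> gain_of_phase s1 vs es H1 = gain_of_phase s1 vs es H2)
       \<and> act_orbit es ` (phases vs es :: 'g group_algebra mat set) =
            {{H \<in> phases vs es. gain_of_phase s1 vs es H = \<psi>} | \<psi>.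
              \<psi> \<in> gain_of_phase s1 vs es ` phases vs es}"
proof -
  have G: "simple_graph V (set es)" "set vs = V" "distinct vs" "distinct es"
    using assms by (auto simp: enumerates_def)
  have equiv: "act_equiv es H1 H2 \<longleftrightarrow> gain_of_phase s1 vs es H1 = gain_of_phase s1 vs es H2"
    if "H1 \<in> phases vs es" "H2 \<in> phases vs es" for H1 H2 :: "'g group_algebra mat"
    using act_equiv_if_gain_of_phase_eq[OF G that] gain_of_phase_act[OF G that(2)]
    by (auto simp: act_equiv_def)
  have orbit: "act_orbit es H =
      {H' \<in> phases vs es. gain_of_phase s1 vs es H' = gain_of_phase s1 vs es H}"
    if "H \<in> phases vs es" for H :: "'g group_algebra mat"
  proof -
    \<comment> \<open>\<open>act_equiv es H' H\<close> has the acted-on matrix second, so it says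
      that \<open>H'\<close> is in the orbit of \<open>H\<close>; such an \<open>H'\<close> is a
      phase because the action preserves phases.\<close>
    have "act_orbit es H = {H' \<in> phases vs es. act_equiv es H' H}"
      using act_in_phases[OF that] by (auto simp: act_orbit_def act_equiv_def)
    then show ?thesis
      using equiv that by auto
  qed
  \<comment> \<open>Each value of the gain map is attained at some phase \<open>H\<close>, so the
    fibers over its image are exactly the fibers through phases.\<close>
  have "act_orbit es ` (phases vs es :: 'g group_algebra mat set) =
      (\<lambda>H. {H' \<in> phases vs es. gain_of_phase s1 vs es H' = gain_of_phase s1 vs es H}) ` phases vs es"
    using orbit by (rule image_cong[OF refl])
  then show ?thesis
    using equiv by (auto simp: image_iff)
qed

end
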